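(* Let $$\mathbf{z}^{(1)}=\big|\mathbf{H}\mathbf{x}+\mathbf{v}^{(1)}+\mathbf{r}\big|,\qquad \mathbf{z}^{(2)}=\big|\mathbf{H}\mathbf{x}e^{j\phi}+\mathbf{v}^{(2)}+\mathbf{r}\big|$$ be element-wise amplitude observations in $\mathbb{R}^M$, where $\mathbf{H}\in\mathbb{C}^{M\times N}$, $\mathbf{x}\in\mathbb{C}^N$, $\mathbf{v}^{(1)},\mathbf{v}^{(2)}\sim\mathcal{CN}(0,\sigma_v^2\mathbf{I})$ is additive white Gaussian noise, and $\mathbf{r}\in\mathbb{C}^M$ is a known reference signal that is much stronger than the information signal, i.e. $|r_m|\gg|s_m+v_m^{(1,2)}|$ for every $m$, with $\mathbf{s}=\mathbf{H}\mathbf{x}$. Given $\mathbf{z}^{(1)}$, $\mathbf{z}^{(2)}$ and $\mathbf{r}$, the estimate of $\mathbf{s}$ for the optimal phase offset $\phi=\phi^\star=\frac{\pi}{2}$ is $$\widehat{\mathbf{s}}=\mathbf{u}^{*}\odot\Big[\big(\mathbf{z}^{(1)}-|\mathbf{r}|\big)-j\big(\mathbf{z}^{(2)}-|\mathbf{r}|\big)\Big]\approx\mathbf{H}\mathbf{x}+\mathbf{v}_{\mathrm{e}},$$ where $\mathbf{u}=(u_1,\dots,u_M)^T$ with $u_m=r_m^*/|r_m|$, and $\mathbf{v}_{\mathrm{e}}\sim\mathcal{CN}(0,\sigma_{v_{\mathrm{e}}}^2\mathbf{I})$ is the effective noise, with the same variance as the original noise, i.e. $\sigma_{v_{\mathr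m{e}}}^2=\sigma_v^2$.
   Context: Here $j$ is the imaginary unit, $|\cdot|$ applied to a vector is the element-wise modulus, $\odot$ is the element-wise product, $(\cdot)^*$ is (element-wise) complex conjugation, $\mathbf{I}$ is the $M\times M$ identity matrix, and $\mathcal{CN}(0,\sigma^2\mathbf{I})$ is the circularly symmetric complex Gaussian distribution with mean zero and covariance $\sigma^2\mathbf{I}$. The setting is a multiple-input multiple-output system with $M$ amplitude-only receivers and $N$ user antennas; $\mathbf{H}$ is the channel matrix and $\mathbf{x}$ the vector of transmitted symbols, sent as $\mathbf{x}$ in a first time slot and as $\mathbf{x}e^{j\phi}$ in a second one, with $\mathbf{H}$ and $\mathbf{r}$ constant across both slots. The sign $\approx$ refers to the first-order Taylor approximation of the amplitudes under the strong-reference assumption, $z_m^{(1)}\approx|r_m|+\Re\{u_m(s_m+v_m^{(1)})\}$ and $z_m^{(2)}\approx|r_m|+\Re\{u_m(s_m e^{j\phi}+v_m^{(2)})\}$, where $\Re$ denotes the real part. The phase offset $\phi^\star=\frac{\pi}{2}$ is called optimal because it (like $-\frac{\pi}{2}$) minimizes the error of the least-squares estimate of each $s_m$ from $z_m^{(1)}-|r_m|$ and $z_m^{(2)}-|r_m|$ based on this approximation; $\widehat{\mathbf{s}}$ is the resulting estimate. *)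

theory Defs
  imports "HOL-Probability.Probability"
begin

(* CN(0, \<sigma>^2 I), given by its density exp (- |w|^2 / \<sigma>^2) / (\<pi> \<sigma>^2)^M with respect to
   Lebesgue measure on C^M; only meaningful for \<sigma> > 0. Each component has total variance
   E |v_m|^2 = \<sigma>^2, i.e. \<sigma>^2 / 2 for its real and for its imaginary part. *)
definition complex_gaussian :: "'a measure \<Rightarrow> real \<Rightarrow> ('a \<Rightarrow> complex ^ 'm) \<Rightarrow> bool" where
  "complex_gaussian P \<sigma> v \<longleftrightarrow>
     distributed P lborel v
       (\<lambda>w. ennreal (exp (- (norm w)\<^sup>2 / \<sigma>\<^sup>2) / (pi * \<sigma>\<^sup>2) ^ CARD('m)))"

definition amplitude :: "complex ^ 'm \<Rightarrow> real ^ 'm" where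
  "amplitude w = (\<chi> m. cmod (w $ m))"

definition ref_phase :: "complex \<Rightarrow> complex" where
  "ref_phase r = cnj r / of_real (cmod r)"

definition taylor_amplitude :: "complex \<Rightarrow> complex \<Rightarrow> real" where
  "taylor_amplitude r w = cmod r + Re (ref_phase r * w)"

(* taylor_amplitude r is the first-order Taylor polynomial of the modulus at r. *)
lemma cmod_has_derivative_ref_phase:
  assumes "r \<noteq> 0"
  shows "(cmod has_derivative (\<lambda>w. Re (ref_phase r * w))) (at r)"
proof -
  have "(\<lambda>w. Re (ref_phase r * w)) = (\<lambda>w. w \<bullet> sgn r)"
    by (rule ext) (simp add: ref_phase_def inner_complex_def sgn_div_norm scaleR_conv_of_real
        add_divide_distrib field_simps)
  then show ?thesis
    using has_derivative_norm[OF assms] by simp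
qed

(* Sum of squared residuals for the two real measurements y1 = Re (u s) and
   y2 = Re (u s e^(j \<phi>)) of the complex unknown s. *)
definition ls_cost :: "complex \<Rightarrow> real \<Rightarrow> real \<Rightarrow> real \<Rightarrow> complex \<Rightarrow> real" where
  "ls_cost u \<phi> y1 y2 s = (y1 - Re (u * s))\<^sup>2 + (y2 - Re (u * (s * cis \<phi>)))\<^sup>2"

definition is_ls_estimate :: "complex \<Rightarrow> real \<Rightarrow> real \<Rightarrow> real \<Rightarrow> complex \<Rightarrow> bool" where
  "is_ls_estimate u \<phi> y1 y2 = is_arg_min (ls_cost u \<phi> y1 y2) (\<lambda>_. True)"

(* The minimizer is unique if and only if sin \<phi> \<noteq> 0, so this is the least-squares estimate
   for such \<phi> and an arbitrary choice otherwise. *)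
definition ls_estimate :: "complex \<Rightarrow> real \<Rightarrow> real \<Rightarrow> real \<Rightarrow> complex" where
  "ls_estimate u \<phi> y1 y2 = arg_min (ls_cost u \<phi> y1 y2) (\<lambda>_. True)"

(* Mean squared error, at phase offset \<phi>, of the least-squares estimate of s computed from the
   linearized amplitudes. *)
definition ls_mse ::
  "'a measure \<Rightarrow> complex \<Rightarrow> complex \<Rightarrow> ('a \<Rightarrow> complex) \<Rightarrow> ('a \<Rightarrow> complex) \<Rightarrow> real \<Rightarrow> ennreal" where
  "ls_mse P r s v1 v2 \<phi> =
     (\<integral>\<^sup>+ \<omega>. ennreal ((cmod (ls_estimate (ref_phase r) \<phi>
                  (taylor_amplitude r (s + v1 \<omega>) - cmod r)
                  (taylor_amplitude r (s * cis \<phi> + v2 \<omega>) - cmod r) - s))\<^sup>2) \<partial>P)"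

(* |r_m| >> |w_m| for every m, with \<kappa> bounding the ratios |w_m| / |r_m|. *)
definition strong_reference :: "real \<Rightarrow> complex ^ 'm \<Rightarrow> complex ^ 'm \<Rightarrow> bool" where
  "strong_reference \<kappa> r w \<longleftrightarrow> (\<forall>m. cmod (w $ m) \<le> \<kappa> * cmod (r $ m))"

end

(* The joint density of two independent CN(0, \<sigma>^2 I) vectors depends on the norm only, so their
   joint distribution is invariant under orthogonal maps of C^M x C^M. The effective noise is a
   component of such an image of (v1, v2), hence CN(0, \<sigma>^2 I) again; the sign change
   (v1, v2) -> (v1, -v2) yields the optimality of the phase offset pi/2. The error of the linearized
   amplitude is at most |w|^2 / |r|. *)
theory Submission
  imports Defs
begin

section \<open>Orthogonal invariance of Lebesgue measure\<close>

lemma nn_integral_lborel_translation: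
  fixes c :: "'a::euclidean_space"
  assumes [measurable]: "f \<in> borel_measurable borel"
  shows "(\<integral>\<^sup>+x. f (x + c) \<partial>lborel) = (\<integral>\<^sup>+x. f x \<partial>lborel)"
proof -
  have "(\<integral>\<^sup>+x. f x \<partial>lborel) = (\<integral>\<^sup>+x. f x \<partial>distr lborel borel ((+) c))"
    by (simp add: lborel_distr_plus)
  then show ?thesis
    by (simp add: nn_integral_distr add.commute)
qed

lemma borel_measurable_orthogonal_transformation:
  fixes f :: "'a::euclidean_space \<Rightarrow> 'a"
  assumes "orthogonal_transformation f"
  shows "f \<in> borel_measurable borel"
  using assms
  by (intro borel_measurable_continuous_onI linear_continuous_on linear_linear[THEN iffD2]
      orthogonal_transformation_linear)

(* Write \<lambda> for lborel, \<mu> for its image under f and B for the unit ball. Both measures are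
   translation invariant, so evaluating the integral of 1_A(f x + y) 1_B(y) over x and y in either
   order gives \<mu>(A) \<lambda>(B) = \<lambda>(A) \<lambda>(B). *)
lemma distr_lborel_orthogonal_transformation:
  fixes f :: "'a::euclidean_space \<Rightarrow> 'a"
  assumes f: "orthogonal_transformation f"
  shows "distr lborel borel f = lborel"
proof (rule measure_eqI)
  note [measurable] = borel_measurable_orthogonal_transformation[OF f]
  have lin: "linear f"
    using f by (rule orthogonal_transformation_linear)
  fix A assume "A \<in> sets (distr lborel borel f)"
  then have [measurable]: "A \<in> sets borel" by simp
  define B :: "'a set" where "B = ball 0 1"
  have [measurable]: "B \<in> sets borel" by (simp add: B_def)
  define \<beta> where "\<beta> = emeasure lborel B"
  have ball: "emeasure lborel (ball c 1) = \<beta>" for c :: 'a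
    by (simp add: \<beta>_def B_def emeasure_ball)
  have \<beta>: "\<beta> \<noteq> 0" "\<beta> \<noteq> \<infinity>"
    using unit_ball_vol_pos[of "real DIM('a)"] unfolding \<beta>_def B_def
    by (auto simp: emeasure_ball simp del: unit_ball_vol_pos)
  \<comment> \<open>Surjectivity of \<open>f\<close> turns the shift by \<open>y\<close> outside
    \<open>f\<close> into a shift of the integration variable.\<close>
  have left: "(\<integral>\<^sup>+x. indicator A (f x + y) \<partial>lborel) = emeasure (distr lborel borel f) A" for y
  proof -
    obtain y' where y': "y = f y'"
      using orthogonal_transformation_surj[OF f] by (metis surjD)
    have "(\<integral>\<^sup>+x. indicator A (f x + y) \<partial>lborel) = (\<integral>\<^sup>+x. indicator A (f (x + y')) \<partial>lborel)"
      by (simp add: y' linear_add[OF lin])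
    also have "\<dots> = (\<integral>\<^sup>+x. indicator A (f x) \<partial>lborel)"
      by (rule nn_integral_lborel_translation) measurable
    also have "\<dots> = (\<integral>\<^sup>+x. indicator A x \<partial>distr lborel borel f)"
      by (subst nn_integral_distr) auto
    finally show ?thesis by simp
  qed
  \<comment> \<open>An isometry pulls a unit ball back to a unit ball, whose volume does not depend
    on its centre.\<close>
  have right: "(\<integral>\<^sup>+x. indicator B (y - f x) \<partial>lborel) = \<beta>" for y
  proof -
    obtain y' where y': "y = f y'"
      using orthogonal_transformation_surj[OF f] by (metis surjD)
    have "norm (f x - y) = norm (y' - x)" for x
      using f by (simp add: y' orthogonal_transformation norm_minus_commute flip: linear_diff[OF lin])
    then have "(\<integral>\<^sup>+x. indicator B (y - f x) \<partial>lborel) = (\<integral>\<^sup>+x. indicator (ball y' 1) x \<partial>lborel)"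
      by (intro nn_integral_cong) (auto simp: B_def indicator_def dist_norm)
    then show ?thesis by (simp add: ball)
  qed
  have "\<beta> * emeasure (distr lborel borel f) A
      = (\<integral>\<^sup>+y. indicator B y * (\<integral>\<^sup>+x. indicator A (f x + y) \<partial>lborel) \<partial>lborel)"
    unfolding left by (subst nn_integral_multc) (auto simp: \<beta>_def intro!: borel_measurable_indicator)
  also have "\<dots> = (\<integral>\<^sup>+y. \<integral>\<^sup>+x. indicator B y * indicator A (f x + y) \<partial>lborel \<partial>lborel)"
    by (intro nn_integral_cong nn_integral_cmult[symmetric]) measurable
  also have "\<dots> = (\<integral>\<^sup>+x. \<integral>\<^sup>+y. indicator B y * indicator A (f x + y) \<partial>lborel \<partial>lborel)"
    by (rule lborel_pair.Fubini') measurable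
  \<comment> \<open>Shifting \<open>y\<close> by \<open>f x\<close> leaves \<open>A\<close>
    evaluated at \<open>y\<close> alone and moves the dependence on \<open>x\<close> into
    \<open>B\<close>, where \<open>right\<close> applies.\<close>
  also have "\<dots> = (\<integral>\<^sup>+x. \<integral>\<^sup>+y. indicator B (y - f x) * indicator A y \<partial>lborel \<partial>lborel)"
  proof (rule nn_integral_cong)
    fix x
    have "(\<integral>\<^sup>+y. indicator B (y - f x) * indicator A y \<partial>lborel)
        = (\<integral>\<^sup>+y. indicator B (y + f x - f x) * indicator A (y + f x) \<partial>lborel)"
      by (rule nn_integral_lborel_translation[symmetric]) measurable
    then show "(\<integral>\<^sup>+y. indicator B y * indicator A (f x + y) \<partial>lborel)
        = (\<integral>\<^sup>+y. indicator B (y - f x) * indicator A y \<partial>lborel)"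
      by (simp add: add.commute)
  qed
  also have "\<dots> = (\<integral>\<^sup>+y. \<integral>\<^sup>+x. indicator B (y - f x) * indicator A y \<partial>lborel \<partial>lborel)"
    by (rule lborel_pair.Fubini') measurable
  also have "\<dots> = (\<integral>\<^sup>+y. \<beta> * indicator A y \<partial>lborel)"
    by (intro nn_integral_cong) (subst nn_integral_multc, auto simp: right)
  also have "\<dots> = \<beta> * emeasure lborel A"
    by (subst nn_integral_cmult) auto
  finally show "emeasure (distr lborel borel f) A = emeasure lborel A"
    using \<beta> by (simp add: ennreal_mult_cancel_left)
qed simp

text \<open>As \<open>g\<close> is \<open>f\<close>-invariant, the law of \<open>X\<close> has
  density \<open>g (f w)\<close>. Its image under \<open>f\<close> then has density \<open>g\<close>
  relative to the image of \<open>lborel\<close>, which is \<open>lborel\<close> itself.\<close>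

lemma distributed_orthogonal_transformation:
  fixes X :: "'a \<Rightarrow> 'b::euclidean_space"
  assumes f: "orthogonal_transformation f"
    and X: "distributed M lborel X g"
    and g: "\<And>w. g (f w) = g w"
  shows "distributed M lborel (\<lambda>\<omega>. f (X \<omega>)) g"
proof -
  note [measurable] = borel_measurable_orthogonal_transformation[OF f]
  have [measurable]: "X \<in> borel_measurable M" "g \<in> borel_measurable borel"
    using X by (auto simp: distributed_def)
  have "distr M lborel (\<lambda>\<omega>. f (X \<omega>)) = distr (distr M lborel X) lborel f"
    by (subst distr_distr) (auto simp: comp_def)
  also have "\<dots> = distr (density lborel (\<lambda>w. g (f w))) lborel f"
    using X by (simp add: distributed_def g)
  also have "\<dots> = density (distr lborel lborel f) g"
    by (simp add: density_distr)
  also have "distr lborel lborel f = distr lborel borel f"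
    by (rule distr_cong) auto
  also have "\<dots> = lborel"
    using f by (rule distr_lborel_orthogonal_transformation)
  finally show ?thesis
    by (simp add: distributed_def)
qed

section \<open>Pairs of independent complex Gaussian vectors\<close>

lemma borel_measurable_complex_gaussian:
  "complex_gaussian P \<sigma> v \<Longrightarrow> v \<in> borel_measurable P"
  by (simp add: complex_gaussian_def distributed_def)

context prob_space
begin

text \<open>Independence multiplies the two densities, and the exponents add up to the squared norm
  of the pair. As a radial function on the product space, the result is visibly invariant under
  isometries.\<close>

lemma distributed_complex_gaussian_pair:
  fixes v1 v2 :: "'a \<Rightarrow> complex ^ 'm"
  assumes v1: "complex_gaussian M \<sigma> v1" and v2: "complex_gaussian M \<sigma> v2"
    and indep: "indep_var borel v1 borel v2"
  shows "distributed M lborel (\<lambda>\<omega>. (v1 \<omega>, v2 \<omega>))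
           (\<lambda>w. ennreal (exp (- (norm w)\<^sup>2 / \<sigma>\<^sup>2) / ((pi * \<sigma>\<^sup>2) ^ CARD('m))\<^sup>2))"
proof -
  have "indep_var lborel v1 lborel v2"
    using indep by (simp add: indep_var_eq)
  then have "distributed M (lborel \<Otimes>\<^sub>M lborel) (\<lambda>\<omega>. (v1 \<omega>, v2 \<omega>))
      (\<lambda>(a, b). ennreal (exp (- (norm a)\<^sup>2 / \<sigma>\<^sup>2) / (pi * \<sigma>\<^sup>2) ^ CARD('m))
         * ennreal (exp (- (norm b)\<^sup>2 / \<sigma>\<^sup>2) / (pi * \<sigma>\<^sup>2) ^ CARD('m)))"
    using v1 v2 unfolding complex_gaussian_def
    by (intro distributed_joint_indep sigma_finite_lborel)
  moreover have "(\<lambda>(a, b). ennreal (exp (- (norm a)\<^sup>2 / \<sigma>\<^sup>2) / (pi * \<sigma>\<^sup>2) ^ CARD('m))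
         * ennreal (exp (- (norm b)\<^sup>2 / \<sigma>\<^sup>2) / (pi * \<sigma>\<^sup>2) ^ CARD('m)))
    = (\<lambda>w :: (complex ^ 'm) \<times> (complex ^ 'm).
         ennreal (exp (- (norm w)\<^sup>2 / \<sigma>\<^sup>2) / ((pi * \<sigma>\<^sup>2) ^ CARD('m))\<^sup>2))"
  proof (rule ext, clarify)
    fix a b :: "complex ^ 'm"
    have "exp (- (norm (a, b))\<^sup>2 / \<sigma>\<^sup>2) = exp (- (norm a)\<^sup>2 / \<sigma>\<^sup>2) * exp (- (norm b)\<^sup>2 / \<sigma>\<^sup>2)"
      by (simp add: norm_prod_def diff_divide_distrib flip: exp_add)
    then show "ennreal (exp (- (norm a)\<^sup>2 / \<sigma>\<^sup>2) / (pi * \<sigma>\<^sup>2) ^ CARD('m))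
         * ennreal (exp (- (norm b)\<^sup>2 / \<sigma>\<^sup>2) / (pi * \<sigma>\<^sup>2) ^ CARD('m))
       = ennreal (exp (- (norm (a, b))\<^sup>2 / \<sigma>\<^sup>2) / ((pi * \<sigma>\<^sup>2) ^ CARD('m))\<^sup>2)"
      by (simp add: power2_eq_square flip: ennreal_mult)
  qed
  ultimately show ?thesis
    by (simp add: lborel_prod)
qed

lemma distributed_complex_gaussian_pair_orthogonal:
  fixes v1 v2 :: "'a \<Rightarrow> complex ^ 'm"
    and f :: "(complex ^ 'm) \<times> (complex ^ 'm) \<Rightarrow> (complex ^ 'm) \<times> (complex ^ 'm)"
  assumes "complex_gaussian M \<sigma> v1" and "complex_gaussian M \<sigma> v2"
    and "indep_var borel v1 borel v2"
    and f: "orthogonal_transformation f"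
  shows "distributed M lborel (\<lambda>\<omega>. f (v1 \<omega>, v2 \<omega>))
           (\<lambda>w. ennreal (exp (- (norm w)\<^sup>2 / \<sigma>\<^sup>2) / ((pi * \<sigma>\<^sup>2) ^ CARD('m))\<^sup>2))"
proof -
  have "norm (f w) = norm w" for w
    using f unfolding orthogonal_transformation by blast
  then show ?thesis
    by (intro distributed_orthogonal_transformation[OF f] distributed_complex_gaussian_pair assms) simp
qed

text \<open>The pair and its image have the same joint density, hence first components with the same
  density \<open>?marginal\<close>. The integral stays unevaluated: the law of \<open>v1\<close>,
  known to be Gaussian, identifies it.\<close>

lemma complex_gaussian_fst_orthogonal:
  fixes v1 v2 :: "'a \<Rightarrow> complex ^ 'm"
    and f :: "(complex ^ 'm) \<times> (complex ^ 'm) \<Rightarrow> (complex ^ 'm) \<times> (complex ^ 'm)"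
  assumes v: "complex_gaussian M \<sigma> v1" "complex_gaussian M \<sigma> v2" "indep_var borel v1 borel v2"
    and f: "orthogonal_transformation f"
  shows "complex_gaussian M \<sigma> (\<lambda>\<omega>. fst (f (v1 \<omega>, v2 \<omega>)))"
proof -
  let ?g = "\<lambda>w. ennreal (exp (- (norm w)\<^sup>2 / \<sigma>\<^sup>2) / ((pi * \<sigma>\<^sup>2) ^ CARD('m))\<^sup>2)"
  let ?marginal = "\<lambda>a. \<integral>\<^sup>+b. ?g (a, b) \<partial>(lborel :: (complex ^ 'm) measure)"
  have "distributed M (lborel \<Otimes>\<^sub>M lborel) (\<lambda>\<omega>. (v1 \<omega>, v2 \<omega>)) ?g"
    using distributed_complex_gaussian_pair[OF v] by (simp add: lborel_prod)
  then have 1: "distributed M lborel v1 ?marginal"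
    by (intro distr_marginal1 sigma_finite_lborel)
  have "distributed M (lborel \<Otimes>\<^sub>M lborel)
      (\<lambda>\<omega>. (fst (f (v1 \<omega>, v2 \<omega>)), snd (f (v1 \<omega>, v2 \<omega>)))) ?g"
    using distributed_complex_gaussian_pair_orthogonal[OF v f] by (simp add: lborel_prod)
  then have "distributed M lborel (\<lambda>\<omega>. fst (f (v1 \<omega>, v2 \<omega>))) ?marginal"
    by (intro distr_marginal1 sigma_finite_lborel)
  with 1 v(1) show ?thesis
    by (simp add: complex_gaussian_def distributed_def)
qed

lemma nn_integral_complex_gaussian_pair_orthogonal:
  fixes v1 v2 :: "'a \<Rightarrow> complex ^ 'm"
    and f :: "(complex ^ 'm) \<times> (complex ^ 'm) \<Rightarrow> (complex ^ 'm) \<times> (complex ^ 'm)"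
  assumes v: "complex_gaussian M \<sigma> v1" "complex_gaussian M \<sigma> v2" "indep_var borel v1 borel v2"
    and f: "orthogonal_transformation f"
    and h: "h \<in> borel_measurable borel"
  shows "(\<integral>\<^sup>+\<omega>. h (f (v1 \<omega>, v2 \<omega>)) \<partial>M) = (\<integral>\<^sup>+\<omega>. h (v1 \<omega>, v2 \<omega>) \<partial>M)"
  using h distributed_nn_integral[OF distributed_complex_gaussian_pair[OF v]]
    distributed_nn_integral[OF distributed_complex_gaussian_pair_orthogonal[OF v f]]
  by simp

end

section \<open>Least-squares estimation from two real measurements\<close>

lemma cmod_ref_phase: "r \<noteq> 0 \<Longrightarrow> cmod (ref_phase r) = 1"
  by (simp add: ref_phase_def norm_divide)

lemma cnj_mult_self_unit: "cmod u = 1 \<Longrightarrow> cnj u * u = 1"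
  by (metis complex_norm_square mult.commute of_real_1 power_one)

lemma unit_mult_eq_iff:
  assumes "cmod u = 1"
  shows "u * t = a \<longleftrightarrow> t = cnj u * a"
proof
  assume "u * t = a"
  then have "cnj u * a = (cnj u * u) * t" by simp
  then show "t = cnj u * a" by (simp add: cnj_mult_self_unit[OF assms])
next
  assume "t = cnj u * a"
  then have "u * t = (cnj u * u) * a" by simp
  then show "u * t = a" by (simp add: cnj_mult_self_unit[OF assms])
qed

text \<open>Vanishing of both residuals is a real linear system in the real and imaginary parts of
  \<open>u * t\<close>, with determinant \<open>- sin \<phi>\<close>. It has exactly one solution,
  so the minimal cost is 0 and the minimizers are the zeros of the cost.\<close>

lemma is_ls_estimate_iff:
  assumes u: "cmod u = 1" and \<phi>: "sin \<phi> \<noteq> 0"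
  shows "is_ls_estimate u \<phi> y1 y2 t \<longleftrightarrow> t = cnj u * Complex y1 ((y1 * cos \<phi> - y2) / sin \<phi>)"
proof -
  have zero: "ls_cost u \<phi> y1 y2 t = 0 \<longleftrightarrow> t = cnj u * Complex y1 ((y1 * cos \<phi> - y2) / sin \<phi>)" for t
  proof -
    have "Re (u * (t * cis \<phi>)) = Re (u * t) * cos \<phi> - Im (u * t) * sin \<phi>"
      by (simp add: algebra_simps)
    then have "ls_cost u \<phi> y1 y2 t = 0 \<longleftrightarrow>
        y1 = Re (u * t) \<and> y2 = Re (u * t) * cos \<phi> - Im (u * t) * sin \<phi>"
      unfolding ls_cost_def by (simp add: sum_power2_eq_zero_iff del: times_complex.sel)
    also have "\<dots> \<longleftrightarrow> u * t = Complex y1 ((y1 * cos \<phi> - y2) / sin \<phi>)"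
      using \<phi> by (auto simp: complex_eq_iff field_simps simp del: times_complex.sel)
    also have "\<dots> \<longleftrightarrow> t = cnj u * Complex y1 ((y1 * cos \<phi> - y2) / sin \<phi>)"
      by (rule unit_mult_eq_iff[OF u])
    finally show ?thesis .
  qed
  have nonneg: "ls_cost u \<phi> y1 y2 t \<ge> 0" for t
    by (simp add: ls_cost_def)
  show ?thesis
    unfolding is_ls_estimate_def is_arg_min_linorder zero[symmetric]
    using zero nonneg by (metis order_antisym)
qed

lemma ls_estimate_eq:
  assumes "cmod u = 1" "sin \<phi> \<noteq> 0"
  shows "ls_estimate u \<phi> y1 y2 = cnj u * Complex y1 ((y1 * cos \<phi> - y2) / sin \<phi>)"
  using is_ls_estimate_iff[OF assms, of y1 y2]
  by (simp add: ls_estimate_def arg_min_def is_ls_estimate_def)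

text \<open>Multiplication by the unit \<open>u\<close> keeps the modulus. The estimate is linear in
  the measurements and exact without noise, so the signal cancels and only \<open>Re (u * a)\<close>
  and \<open>Re (u * b)\<close> remain.\<close>

lemma ls_estimate_error:
  assumes r: "r \<noteq> 0" and \<phi>: "sin \<phi> \<noteq> 0"
  defines "u \<equiv> ref_phase r"
  shows "(cmod (ls_estimate u \<phi>
            (taylor_amplitude r (s + a) - cmod r)
            (taylor_amplitude r (s * cis \<phi> + b) - cmod r) - s))\<^sup>2
       = (Re (u * a))\<^sup>2 + ((Re (u * a) * cos \<phi> - Re (u * b)) / sin \<phi>)\<^sup>2" (is "(cmod (?e - s))\<^sup>2 = _")
proof -
  have u: "cmod u = 1"
    using r by (simp add: u_def cmod_ref_phase)
  define y1 y2 where "y1 = taylor_amplitude r (s + a) - cmod r"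
    and "y2 = taylor_amplitude r (s * cis \<phi> + b) - cmod r"
  have "Re (u * (s * cis \<phi>)) = Re (u * s) * cos \<phi> - Im (u * s) * sin \<phi>"
    by (simp add: algebra_simps)
  then have y: "y1 = Re (u * s) + Re (u * a)"
    "y2 = Re (u * s) * cos \<phi> - Im (u * s) * sin \<phi> + Re (u * b)"
    by (simp_all add: y1_def y2_def taylor_amplitude_def u_def distrib_left)
  have "u * ?e = Complex y1 ((y1 * cos \<phi> - y2) / sin \<phi>)"
    unfolding y1_def[symmetric] y2_def[symmetric] ls_estimate_eq[OF u \<phi>]
    using unit_mult_eq_iff[OF u] by blast
  then have "u * (?e - s) = Complex (Re (u * a)) ((Re (u * a) * cos \<phi> - Re (u * b)) / sin \<phi>)"
    using \<phi> unfolding right_diff_distrib by (simp add: y complex_eq_iff field_simps)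
  moreover have "cmod (?e - s) = cmod (u * (?e - s))"
    by (simp add: norm_mult u)
  ultimately show ?thesis
    by (simp add: cmod_power2)
qed

section \<open>Optimality of the phase offset \<pi> / 2\<close>

text \<open>Here \<open>c\<close> and \<open>s\<close> are cosine and sine of the offset, and the
  left side is twice the error at \<open>c = 0\<close>, \<open>s = 1\<close>. Adding the errors for
  \<open>b\<close> and \<open>- b\<close> cancels the mixed terms; what is left is bounded using
  \<open>s\<^sup>2 \<le> 1\<close>.\<close>

lemma real_error_symmetrization:
  fixes a b c s :: real
  assumes "c\<^sup>2 + s\<^sup>2 = 1" "s \<noteq> 0"
  shows "2 * (a\<^sup>2 + b\<^sup>2) \<le> (a\<^sup>2 + ((a * c - b) / s)\<^sup>2) + (a\<^sup>2 + ((a * c + b) / s)\<^sup>2)"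
proof -
  have "s\<^sup>2 \<le> 1" "s\<^sup>2 > 0"
    using assms zero_le_power2[of c] by (linarith, simp)
  then have "b\<^sup>2 \<le> b\<^sup>2 / s\<^sup>2"
    by (simp add: field_simps mult_left_le)
  also have "\<dots> \<le> ((a * c)\<^sup>2 + b\<^sup>2) / s\<^sup>2"
    by (simp add: divide_right_mono)
  also have "2 * \<dots> = ((a * c - b) / s)\<^sup>2 + ((a * c + b) / s)\<^sup>2"
    by (simp add: power_divide power2_sum power2_diff flip: add_divide_distrib)
  finally show ?thesis by simp
qed

(* Since (v1, v2) and (v1, -v2) have the same distribution, averaging the two squared errors
   removes the cross term of the real noise components. *)
lemma (in prob_space) is_arg_min_ls_mse:
  fixes v1 v2 :: "'a \<Rightarrow> complex ^ 'm"
  assumes v: "complex_gaussian M \<sigma> v1" "complex_gaussian M \<sigma> v2" "indep_var borel v1 borel v2"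
    and r: "r \<noteq> 0"
  shows "is_arg_min (ls_mse M r s (\<lambda>\<omega>. v1 \<omega> $ m) (\<lambda>\<omega>. v2 \<omega> $ m)) (\<lambda>\<phi>. sin \<phi> \<noteq> 0) (pi / 2)"
proof -
  let ?mse = "ls_mse M r s (\<lambda>\<omega>. v1 \<omega> $ m) (\<lambda>\<omega>. v2 \<omega> $ m)"
  note [measurable] = v(1,2)[THEN borel_measurable_complex_gaussian]
  \<comment> \<open>\<open>n w\<close> is what the noise \<open>w\<close> adds to the linearized
    amplitude at receiver \<open>m\<close>.\<close>
  define n :: "complex ^ 'm \<Rightarrow> real" where "n w = Re (ref_phase r * w $ m)" for w
  have [measurable]: "n \<in> borel_measurable borel"
    unfolding n_def by (intro borel_measurable_continuous_onI continuous_intros)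
  have n_minus: "n (- w) = - n w" for w
    by (simp add: n_def)
  have mse: "?mse \<phi> = (\<integral>\<^sup>+\<omega>. ennreal ((n (v1 \<omega>))\<^sup>2 + ((n (v1 \<omega>) * cos \<phi> - n (v2 \<omega>)) / sin \<phi>)\<^sup>2) \<partial>M)"
    if "sin \<phi> \<noteq> 0" for \<phi>
    unfolding ls_mse_def ls_estimate_error[OF r that] n_def ..
  have "?mse (pi / 2) \<le> ?mse \<phi>" if \<phi>: "sin \<phi> \<noteq> 0" for \<phi>
  proof -
    \<comment> \<open>The squared error as a function of the noise pair, the form to which
      invariance of the joint law applies.\<close>
    define h where "h = (\<lambda>w. ennreal ((n (fst w))\<^sup>2 + ((n (fst w) * cos \<phi> - n (snd w)) / sin \<phi>)\<^sup>2))"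
    have [measurable]: "h \<in> borel_measurable borel"
      unfolding h_def borel_prod[symmetric] by measurable
    have flip: "orthogonal_transformation (\<lambda>w :: (complex ^ 'm) \<times> (complex ^ 'm). (fst w, - snd w))"
      unfolding orthogonal_transformation
      by (auto intro!: linearI simp: norm_prod_def)
    \<comment> \<open>At \<pi> / 2 the cosine is 0 and the sine is 1, so the squared error is a
      plain sum of two squares.\<close>
    have "2 * ?mse (pi / 2) = (\<integral>\<^sup>+\<omega>. ennreal (2 * ((n (v1 \<omega>))\<^sup>2 + (n (v2 \<omega>))\<^sup>2)) \<partial>M)"
      by (simp add: mse nn_integral_cmult ennreal_mult del: ennreal_plus distrib_left_numeral)
    also have "\<dots> \<le> (\<integral>\<^sup>+\<omega>. h (v1 \<omega>, v2 \<omega>) + h (v1 \<omega>, - v2 \<omega>) \<partial>M)"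
    proof (rule nn_integral_mono)
      fix \<omega>
      show "ennreal (2 * ((n (v1 \<omega>))\<^sup>2 + (n (v2 \<omega>))\<^sup>2)) \<le> h (v1 \<omega>, v2 \<omega>) + h (v1 \<omega>, - v2 \<omega>)"
        using real_error_symmetrization[of "cos \<phi>" "sin \<phi>" "n (v1 \<omega>)" "n (v2 \<omega>)"] \<phi>
        by (simp add: h_def n_minus flip: ennreal_plus)
    qed
    also have "\<dots> = (\<integral>\<^sup>+\<omega>. h (v1 \<omega>, v2 \<omega>) \<partial>M) + (\<integral>\<^sup>+\<omega>. h (v1 \<omega>, - v2 \<omega>) \<partial>M)"
      by (rule nn_integral_add) measurable
    also have "(\<integral>\<^sup>+\<omega>. h (v1 \<omega>, - v2 \<omega>) \<partial>M) = (\<integral>\<^sup>+\<omega>. h (v1 \<omega>, v2 \<omega>) \<partial>M)"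
      using nn_integral_complex_gaussian_pair_orthogonal[OF v flip, of h] by simp
    also have "(\<integral>\<^sup>+\<omega>. h (v1 \<omega>, v2 \<omega>) \<partial>M) = ?mse \<phi>"
      by (simp add: mse[OF \<phi>] h_def)
    also have "?mse \<phi> + ?mse \<phi> = 2 * ?mse \<phi>"
      by (simp add: mult_2)
    \<comment> \<open>The factor 2 is neither 0 nor infinite in \<open>ennreal\<close>, so it
      cancels.\<close>
    finally show ?thesis
      by (subst (asm) ennreal_mult_le_mult_iff) auto
  qed
  then show ?thesis
    by (simp add: is_arg_min_linorder)
qed

section \<open>Effective noise\<close>

lemma Re_unit_mult_square_sum:
  assumes "cmod u = 1"
  shows "(Re (u * a))\<^sup>2 + (Im (u * a))\<^sup>2 = (cmod a)\<^sup>2"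
  by (simp add: assms norm_mult del: times_complex.sel flip: cmod_power2)

lemma norm_square_vec_complex: "(norm w)\<^sup>2 = (\<Sum>m\<in>UNIV. (cmod (w $ m))\<^sup>2)"
  for w :: "complex ^ 'm"
  by (simp add: norm_vec_def L2_set_def sum_nonneg)

(* The effective noise keeps the real parts of u v1 and u v2. Collecting the discarded imaginary
   parts in a second vector makes the map (v1, v2) -> (v_e, v_e') orthogonal. *)
lemma orthogonal_transformation_effective_noise:
  fixes u :: "complex ^ 'm"
  assumes u: "\<And>m. cmod (u $ m) = 1"
  shows "orthogonal_transformation (\<lambda>w :: (complex ^ 'm) \<times> (complex ^ 'm).
      (\<chi> m. cnj (u $ m) * Complex (Re (u $ m * fst w $ m)) (- Re (u $ m * snd w $ m)),
       \<chi> m. cnj (u $ m) * Complex (Im (u $ m * fst w $ m)) (- Im (u $ m * snd w $ m))))"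
    (is "orthogonal_transformation ?f")
  unfolding orthogonal_transformation
proof (intro conjI allI)
  show "linear ?f"
    by (rule linearI) (auto simp: vec_eq_iff complex_eq_iff algebra_simps)
  fix w :: "(complex ^ 'm) \<times> (complex ^ 'm)"
  have "(norm (?f w))\<^sup>2 = (\<Sum>m\<in>UNIV.
      ((Re (u $ m * fst w $ m))\<^sup>2 + (Re (u $ m * snd w $ m))\<^sup>2)
      + ((Im (u $ m * fst w $ m))\<^sup>2 + (Im (u $ m * snd w $ m))\<^sup>2))"
    by (simp add: norm_prod_def norm_square_vec_complex norm_mult u cmod_power2 sum.distrib
        sum_nonneg add_nonneg_nonneg del: times_complex.sel)
  \<comment> \<open>Regrouped by time slot: the real and imaginary parts of the rotated
    \<open>fst w $ m\<close> together give its squared modulus, and likewise for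
    \<open>snd w $ m\<close>.\<close>
  also have "\<dots> = (\<Sum>m\<in>UNIV. (cmod (fst w $ m))\<^sup>2 + (cmod (snd w $ m))\<^sup>2)"
  proof (rule sum.cong[OF refl])
    fix m
    show "((Re (u $ m * fst w $ m))\<^sup>2 + (Re (u $ m * snd w $ m))\<^sup>2)
        + ((Im (u $ m * fst w $ m))\<^sup>2 + (Im (u $ m * snd w $ m))\<^sup>2)
      = (cmod (fst w $ m))\<^sup>2 + (cmod (snd w $ m))\<^sup>2"
      using Re_unit_mult_square_sum[OF u, of m "fst w $ m"]
        Re_unit_mult_square_sum[OF u, of m "snd w $ m"] by linarith
  qed
  also have "\<dots> = (norm w)\<^sup>2"
    by (simp add: norm_prod_def norm_square_vec_complex sum.distrib sum_nonneg add_nonneg_nonneg)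
  finally show "norm (?f w) = norm w"
    by simp
qed

section \<open>Error of the linearized amplitude\<close>

text \<open>Rotation by \<open>ref_phase r\<close> takes \<open>r\<close> to the positive real
  \<open>\<rho>\<close> and \<open>w\<close> to \<open>Complex a b\<close>, so the modulus of
  \<open>Complex (\<rho> + a) b\<close> is compared with its real part \<open>\<rho> + a\<close>. It
  is no smaller, and squaring shows that it is at most \<open>\<rho> + a + q\<close>.\<close>

lemma taylor_amplitude_error:
  assumes r: "r \<noteq> 0"
  shows "\<bar>cmod (w + r) - taylor_amplitude r w\<bar> \<le> (cmod w)\<^sup>2 / cmod r"
proof -
  define \<rho> a b where "\<rho> = cmod r" and "a = Re (ref_phase r * w)" and "b = Im (ref_phase r * w)"
  have \<rho>: "\<rho> > 0"
    using r by (simp add: \<rho>_def)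
  have u: "cmod (ref_phase r) = 1"
    using r by (rule cmod_ref_phase)
  have w: "(cmod w)\<^sup>2 = a\<^sup>2 + b\<^sup>2"
    by (simp add: a_def b_def Re_unit_mult_square_sum[OF u] del: times_complex.sel)
  have "ref_phase r * r = of_real \<rho>"
    using r by (simp add: ref_phase_def \<rho>_def power2_eq_square field_simps flip: complex_norm_square)
  then have "ref_phase r * (w + r) = Complex (\<rho> + a) b"
    by (simp add: distrib_left complex_eq_iff a_def b_def del: times_complex.sel)
  then have mod: "cmod (w + r) = sqrt ((\<rho> + a)\<^sup>2 + b\<^sup>2)"
    by (metis complex_norm mult_1 norm_mult u)
  define q where "q = (a\<^sup>2 + b\<^sup>2) / \<rho>"
  have q: "\<rho> * q = a\<^sup>2 + b\<^sup>2"
    using \<rho> by (simp add: q_def)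
  \<comment> \<open>Completing the square gives \<open>\<rho> + a + q \<ge> 0\<close> also when
    \<open>\<rho> + a\<close> is negative, as the passage from squares to roots requires.\<close>
  have "\<rho> * (\<rho> + a + q) = (\<rho> / 2)\<^sup>2 * 3 + (\<rho> / 2 + a)\<^sup>2 + b\<^sup>2"
    using q by (simp add: power2_eq_square algebra_simps)
  then have "\<rho> * (\<rho> + a + q) \<ge> 0"
    by simp
  then have pos: "\<rho> + a + q \<ge> 0"
    using \<rho> by (simp add: zero_le_mult_iff)
  have "(\<rho> + a + q)\<^sup>2 = (\<rho> + a)\<^sup>2 + 2 * (\<rho> * q) + 2 * a * q + q\<^sup>2"
    by (simp add: power2_eq_square algebra_simps)
  \<comment> \<open>As \<open>2 * (\<rho> * q)\<close> is twice
    \<open>a\<^sup>2 + b\<^sup>2\<close>, one \<open>b\<^sup>2\<close> completes the squared modulus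
    and the surplus is a sum of squares.\<close>
  also have "\<dots> = (\<rho> + a)\<^sup>2 + b\<^sup>2 + (a\<^sup>2 + b\<^sup>2 + (a + q)\<^sup>2)"
    unfolding q by (simp add: power2_eq_square algebra_simps)
  finally have "(\<rho> + a)\<^sup>2 + b\<^sup>2 \<le> (\<rho> + a + q)\<^sup>2"
    by simp
  then have "sqrt ((\<rho> + a)\<^sup>2 + b\<^sup>2) \<le> \<rho> + a + q"
    using pos by (rule real_le_lsqrt[rotated])
  moreover have "\<rho> + a \<le> sqrt ((\<rho> + a)\<^sup>2 + b\<^sup>2)"
    by (rule real_le_rsqrt) simp
  ultimately show ?thesis
    by (simp add: mod w q_def taylor_amplitude_def \<rho>_def a_def)
qed

text \<open>The ratio bound \<open>\<kappa>\<close> absorbs one factor \<open>cmod w\<close> of the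
  quadratic error, which makes the error small relative to \<open>cmod w\<close>.\<close>

lemma taylor_amplitude_error_strong_reference:
  assumes "r \<noteq> 0" and "cmod w \<le> \<kappa> * cmod r"
  shows "\<bar>cmod (w + r) - taylor_amplitude r w\<bar> \<le> \<kappa> * cmod w"
proof -
  have "(cmod w)\<^sup>2 / cmod r \<le> \<kappa> * cmod w"
    using assms mult_right_mono[OF assms(2), of "cmod w"]
    by (simp add: power2_eq_square field_simps)
  then show ?thesis
    using taylor_amplitude_error[OF assms(1), of w] by linarith
qed

text \<open>The sign \<approx> is made precise twice, with one \<open>v_e\<close>: as an identity
  for the linearized amplitudes and as a deviation bound for the true ones. The ratio
  \<open>\<kappa>\<close> is quantified after the outcome because Gaussian noise is unbounded, so
  that no fixed ratio holds almost surely.\<close>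

theorem corollary1:
  fixes P :: "'a measure"
    and H :: "complex ^ 'n ^ 'm" and x :: "complex ^ 'n"
    and r s u :: "complex ^ 'm"
    and v1 v2 w1 :: "'a \<Rightarrow> complex ^ 'm" and w2 :: "real \<Rightarrow> 'a \<Rightarrow> complex ^ 'm"
    and z1 :: "'a \<Rightarrow> real ^ 'm" and z2 :: "real \<Rightarrow> 'a \<Rightarrow> real ^ 'm"
    and s_hat :: "real ^ 'm \<Rightarrow> real ^ 'm \<Rightarrow> complex ^ 'm"
    and \<sigma> :: real
  assumes "prob_space P"
    and "\<sigma> > 0"
    and "complex_gaussian P \<sigma> v1" and "complex_gaussian P \<sigma> v2"
    and "prob_space.indep_var P borel v1 borel v2"
    and "\<And>m. r $ m \<noteq> 0"
    and "s = H *v x"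
    and "u = (\<chi> m. ref_phase (r $ m))"
    and "\<And>\<omega>. w1 \<omega> = H *v x + v1 \<omega>"
    and "\<And>\<phi> \<omega>. w2 \<phi> \<omega> = H *v (cis \<phi> *s x) + v2 \<omega>"
    and "\<And>\<omega>. z1 \<omega> = amplitude (w1 \<omega> + r)"
    and "\<And>\<phi> \<omega>. z2 \<phi> \<omega> = amplitude (w2 \<phi> \<omega> + r)"
    and "\<And>a b. s_hat a b =
           (\<chi> m. cnj (u $ m) * (of_real ((a - amplitude r) $ m) - \<i> * of_real ((b - amplitude r) $ m)))"
  shows "(\<forall>m. is_arg_min (ls_mse P (r $ m) (s $ m) (\<lambda>\<omega>. v1 \<omega> $ m) (\<lambda>\<omega>. v2 \<omega> $ m))
                (\<lambda>\<phi>. sin \<phi> \<noteq> 0) (pi / 2))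
    \<and> (\<forall>\<omega>\<in>space P. \<forall>t.
         (\<forall>m. is_ls_estimate (u $ m) (pi / 2)
                ((z1 \<omega> - amplitude r) $ m) ((z2 (pi / 2) \<omega> - amplitude r) $ m) (t $ m))
         \<longleftrightarrow> t = s_hat (z1 \<omega>) (z2 (pi / 2) \<omega>))
    \<and> (\<exists>v_e. complex_gaussian P \<sigma> v_e
         \<and> (\<forall>\<omega>\<in>space P.
              s_hat (\<chi> m. taylor_amplitude (r $ m) (w1 \<omega> $ m))
                    (\<chi> m. taylor_amplitude (r $ m) (w2 (pi / 2) \<omega> $ m)) = H *v x + v_e \<omega>)
         \<and> (\<forall>\<omega>\<in>space P. \<forall>\<kappa>.
              strong_reference \<kappa> r (w1 \<omega>) \<and> strong_reference \<kappa> r (w2 (pi / 2) \<omega>) \<longrightarrow>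
              (\<forall>m. cmod (s_hat (z1 \<omega>) (z2 (pi / 2) \<omega>) $ m - (H *v x + v_e \<omega>) $ m)
                     \<le> \<kappa> * (cmod (w1 \<omega> $ m) + cmod (w2 (pi / 2) \<omega> $ m)))))"
proof -
  interpret prob_space P by fact
  note gauss = assms(3-5) and r = assms(6) and s = assms(7) and u_def = assms(8)
    and w1 = assms(9) and w2 = assms(10) and z1 = assms(11) and z2 = assms(12) and s_hat = assms(13)
  have u: "cmod (u $ m) = 1" for m
    using r by (simp add: u_def cmod_ref_phase)
  \<comment> \<open>General in \<open>a\<close> and \<open>b\<close>, as it serves both the true and
    the linearized amplitudes.\<close>
  have s_hat_Complex: "s_hat a b $ m
      = cnj (u $ m) * Complex (a $ m - cmod (r $ m)) (- (b $ m - cmod (r $ m)))" for a b m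
  proof -
    have "of_real c - \<i> * of_real d = Complex c (- d)" for c d
      by (simp add: complex_eq_iff)
    then show ?thesis
      by (simp add: s_hat amplitude_def del: of_real_diff minus_diff_eq)
  qed
  \<comment> \<open>What the estimator makes of the noise: the first slot supplies the real part and
    the second, negated, the imaginary part. This is the first component of the orthogonal image of
    \<open>(v1, v2)\<close>.\<close>
  define v_e where "v_e \<omega> =
    (\<chi> m. cnj (u $ m) * Complex (Re (u $ m * v1 \<omega> $ m)) (- Re (u $ m * v2 \<omega> $ m)))" for \<omega>
  have "is_arg_min (ls_mse P (r $ m) (s $ m) (\<lambda>\<omega>. v1 \<omega> $ m) (\<lambda>\<omega>. v2 \<omega> $ m))
      (\<lambda>\<phi>. sin \<phi> \<noteq> 0) (pi / 2)" for m
    using gauss r by (rule is_arg_min_ls_mse)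
  \<comment> \<open>At \<pi> / 2 the term \<open>(y1 * cos \<phi> - y2) / sin \<phi>\<close> is
    \<open>- y2\<close>, which produces the \<open>- \<i>\<close> in \<open>s_hat\<close>.\<close>
  moreover have "(\<forall>m. is_ls_estimate (u $ m) (pi / 2)
        ((z1 \<omega> - amplitude r) $ m) ((z2 (pi / 2) \<omega> - amplitude r) $ m) (t $ m))
      \<longleftrightarrow> t = s_hat (z1 \<omega>) (z2 (pi / 2) \<omega>)" for \<omega> t
    by (simp add: is_ls_estimate_iff[OF u] vec_eq_iff s_hat_Complex amplitude_def)
  moreover have "complex_gaussian P \<sigma> v_e"
    using complex_gaussian_fst_orthogonal[OF gauss orthogonal_transformation_effective_noise[OF u]]
    by (simp add: v_e_def[abs_def])
  moreover have linearized: "s_hat (\<chi> m. taylor_amplitude (r $ m) (w1 \<omega> $ m))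
      (\<chi> m. taylor_amplitude (r $ m) (w2 (pi / 2) \<omega> $ m)) = H *v x + v_e \<omega>" for \<omega>
  proof (rule vec_eq_iff[THEN iffD2], rule allI)
    fix m
    \<comment> \<open>The phase factor passes through the linear map \<open>H\<close> and multiplies
      \<open>s\<close> by the imaginary unit, so the second slot measures
      \<open>- Im (u $ m * s $ m)\<close>, the part missing from the first.\<close>
    have "H *v (cis (pi / 2) *s x) = cis (pi / 2) *s (H *v x)"
      by (rule vector_scalar_commute)
    then have w2_quadrature: "w2 (pi / 2) \<omega> $ m = \<i> * s $ m + v2 \<omega> $ m"
      by (simp add: w2 s)
    have "s_hat (\<chi> m. taylor_amplitude (r $ m) (w1 \<omega> $ m))
        (\<chi> m. taylor_amplitude (r $ m) (w2 (pi / 2) \<omega> $ m)) $ m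
      = cnj (u $ m) * (u $ m * s $ m + Complex (Re (u $ m * v1 \<omega> $ m)) (- Re (u $ m * v2 \<omega> $ m)))"
      by (simp add: s_hat_Complex taylor_amplitude_def u_def w1 w2_quadrature
          s[symmetric] complex_eq_iff algebra_simps)
    also have "\<dots> = (H *v x + v_e \<omega>) $ m"
      using cnj_mult_self_unit[OF u, of m]
      by (simp add: distrib_left v_e_def s flip: mult.assoc)
    finally show "s_hat (\<chi> m. taylor_amplitude (r $ m) (w1 \<omega> $ m))
        (\<chi> m. taylor_amplitude (r $ m) (w2 (pi / 2) \<omega> $ m)) $ m = (H *v x + v_e \<omega>) $ m" .
  qed
  moreover have "cmod (s_hat (z1 \<omega>) (z2 (pi / 2) \<omega>) $ m - (H *v x + v_e \<omega>) $ m)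
      \<le> \<kappa> * (cmod (w1 \<omega> $ m) + cmod (w2 (pi / 2) \<omega> $ m))"
    if "strong_reference \<kappa> r (w1 \<omega>)" "strong_reference \<kappa> r (w2 (pi / 2) \<omega>)" for \<kappa> \<omega> m
  proof -
    \<comment> \<open>Both estimates subtract the same \<open>amplitude r\<close>, so they differ
      only by the linearization errors \<open>d\<close>, one in the real and one in the imaginary
      part.\<close>
    define d where "d w = cmod (w $ m + r $ m) - taylor_amplitude (r $ m) (w $ m)" for w
    have "s_hat (z1 \<omega>) (z2 (pi / 2) \<omega>) $ m - (H *v x + v_e \<omega>) $ m
        = cnj (u $ m) * Complex (d (w1 \<omega>)) (- d (w2 (pi / 2) \<omega>))"
      unfolding linearized[symmetric] s_hat_Complex right_diff_distrib[symmetric]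
      by (simp add: d_def z1 z2 amplitude_def complex_eq_iff)
    then have "cmod (s_hat (z1 \<omega>) (z2 (pi / 2) \<omega>) $ m - (H *v x + v_e \<omega>) $ m)
        \<le> \<bar>d (w1 \<omega>)\<bar> + \<bar>d (w2 (pi / 2) \<omega>)\<bar>"
      using cmod_le[of "Complex (d (w1 \<omega>)) (- d (w2 (pi / 2) \<omega>))"] by (simp add: norm_mult u)
    moreover have "\<bar>d (w1 \<omega>)\<bar> \<le> \<kappa> * cmod (w1 \<omega> $ m)"
      "\<bar>d (w2 (pi / 2) \<omega>)\<bar> \<le> \<kappa> * cmod (w2 (pi / 2) \<omega> $ m)"
      using that r unfolding d_def strong_reference_def
      by (auto intro!: taylor_amplitude_error_strong_reference)
    ultimately show ?thesis
      by (simp add: distrib_left)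
  qed
  ultimately show ?thesis
    by blast
qed

end
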